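(* Let $(\mathfrak g,\omega)$ be a symplectic Lie algebra such that $\mathfrak g$ is completely solvable. Then $(\mathfrak g,\omega)$ is completely reducible.
   Context: All Lie algebras are finite-dimensional over a fixed field $k$ of characteristic $0$. A symplectic Lie algebra $(\mathfrak g,\omega)$ is a Lie algebra $\mathfrak g$ with a non-degenerate alternating form $\omega$ satisfying $\omega([u,v],w)+\omega([w,u],v)+\omega([v,w],u)=0$ for all $u,v,w$. For a subspace $W$, $W^{\perp_\omega}=\{v:\omega(v,w)=0\ \forall w\in W\}$; $W$ is isotropic if $W\subseteq W^{\perp_\omega}$. A Lie algebra is completely solvable if it admits a complete flag of ideals, i.e. a chain of ideals $0=\mathfrak i_0\subset\mathfrak i_1\subset\dots\subset\mathfrak i_n=\mathfrak g$ with $\dim\mathfrak i_j=j$. If $\mathfrak j$ is an isotropic ideal of $(\mathfrak g,\omega)$, then $\mathfrak j^{\perp_\omega}$ is a subalgebra containing $\mathfrak j$ as an ideal, and $\omega$ induces a symplectic form $\bar\omega$ on $\bar{\mathfrak g}=\mathfrak j^{\perp_\omega}/\mathfrak j$; $(\bar{\mathfrak g},\bar\omega)$ is called the symplectic reduction of $(\mathfrak g,\omega)$ with respect to $\mathfrak j$. A symplectic Lie algebra is completely reducible if there is a finite sequence of symplectic Lie algebras starting with it, each term being a symplectic reduction of the preceding one, and ending with the trivial symplectic Lie algebra $\{0\}$. *)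

theory Defs
  imports "Jordan_Normal_Form.Missing_VectorSpace" "HOL-Algebra.AbelCoset"
begin

text \<open>
  The underlying vector space is the \<open>module\<close> part of the record; as in the
  locale \<^locale>\<open>vectorspace\<close>, the inherited fields \<open>mult\<close> and \<open>one\<close> carry no meaning.
\<close>

record ('k, 'v) lie = "('k, 'v) module" +
  bracket :: "'v \<Rightarrow> 'v \<Rightarrow> 'v"

record ('k, 'v) symplectic_lie = "('k, 'v) lie" +
  form :: "'v \<Rightarrow> 'v \<Rightarrow> 'k"

locale lie_algebra = vectorspace K L
  for K :: "('k, 'r) ring_scheme" and L :: "('k, 'v, 'm) lie_scheme" +
  assumes char_0: "\<And>n::nat. n > 0 \<Longrightarrow> [n] \<cdot>\<^bsub>K\<^esub> \<one>\<^bsub>K\<^esub> \<noteq> \<zero>\<^bsub>K\<^esub>"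
    and finite_dimensional: "fin_dim"
    and bracket_closed:
      "\<lbrakk>x \<in> carrier L; y \<in> carrier L\<rbrakk> \<Longrightarrow> bracket L x y \<in> carrier L"
    and bracket_add_left:
      "\<lbrakk>x \<in> carrier L; y \<in> carrier L; z \<in> carrier L\<rbrakk> \<Longrightarrow>
        bracket L (x \<oplus>\<^bsub>L\<^esub> y) z = bracket L x z \<oplus>\<^bsub>L\<^esub> bracket L y z"
    and bracket_add_right:
      "\<lbrakk>x \<in> carrier L; y \<in> carrier L; z \<in> carrier L\<rbrakk> \<Longrightarrow>
        bracket L x (y \<oplus>\<^bsub>L\<^esub> z) = bracket L x y \<oplus>\<^bsub>L\<^esub> bracket L x z"
    and bracket_smult_left:
      "\<lbrakk>c \<in> carrier K; x \<in> carrier L; y \<in> carrier L\<rbrakk> \<Longrightarrow>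
        bracket L (c \<odot>\<^bsub>L\<^esub> x) y = c \<odot>\<^bsub>L\<^esub> bracket L x y"
    and bracket_smult_right:
      "\<lbrakk>c \<in> carrier K; x \<in> carrier L; y \<in> carrier L\<rbrakk> \<Longrightarrow>
        bracket L x (c \<odot>\<^bsub>L\<^esub> y) = c \<odot>\<^bsub>L\<^esub> bracket L x y"
    and bracket_self: "x \<in> carrier L \<Longrightarrow> bracket L x x = \<zero>\<^bsub>L\<^esub>"
    and jacobi:
      "\<lbrakk>x \<in> carrier L; y \<in> carrier L; z \<in> carrier L\<rbrakk> \<Longrightarrow>
        bracket L x (bracket L y z) \<oplus>\<^bsub>L\<^esub> bracket L y (bracket L z x)
          \<oplus>\<^bsub>L\<^esub> bracket L z (bracket L x y) = \<zero>\<^bsub>L\<^esub>"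

locale symplectic_lie_algebra = lie_algebra K S
  for K :: "('k, 'r) ring_scheme" and S :: "('k, 'v, 'm) symplectic_lie_scheme" +
  assumes form_closed:
      "\<lbrakk>x \<in> carrier S; y \<in> carrier S\<rbrakk> \<Longrightarrow> form S x y \<in> carrier K"
    and form_add_left:
      "\<lbrakk>x \<in> carrier S; y \<in> carrier S; z \<in> carrier S\<rbrakk> \<Longrightarrow>
        form S (x \<oplus>\<^bsub>S\<^esub> y) z = form S x z \<oplus>\<^bsub>K\<^esub> form S y z"
    and form_add_right:
      "\<lbrakk>x \<in> carrier S; y \<in> carrier S; z \<in> carrier S\<rbrakk> \<Longrightarrow>
        form S x (y \<oplus>\<^bsub>S\<^esub> z) = form S x y \<oplus>\<^bsub>K\<^esub> form S x z"
    and form_smult_left: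
      "\<lbrakk>c \<in> carrier K; x \<in> carrier S; y \<in> carrier S\<rbrakk> \<Longrightarrow>
        form S (c \<odot>\<^bsub>S\<^esub> x) y = c \<otimes>\<^bsub>K\<^esub> form S x y"
    and form_smult_right:
      "\<lbrakk>c \<in> carrier K; x \<in> carrier S; y \<in> carrier S\<rbrakk> \<Longrightarrow>
        form S x (c \<odot>\<^bsub>S\<^esub> y) = c \<otimes>\<^bsub>K\<^esub> form S x y"
    and form_alternating: "x \<in> carrier S \<Longrightarrow> form S x x = \<zero>\<^bsub>K\<^esub>"
    and form_nondegenerate:
      "\<lbrakk>x \<in> carrier S; \<And>y. y \<in> carrier S \<Longrightarrow> form S x y = \<zero>\<^bsub>K\<^esub>\<rbrakk> \<Longrightarrow> x = \<zero>\<^bsub>S\<^esub>"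
    and form_closed_cocycle:
      "\<lbrakk>u \<in> carrier S; v \<in> carrier S; w \<in> carrier S\<rbrakk> \<Longrightarrow>
        form S (bracket S u v) w \<oplus>\<^bsub>K\<^esub> form S (bracket S w u) v
          \<oplus>\<^bsub>K\<^esub> form S (bracket S v w) u = \<zero>\<^bsub>K\<^esub>"

definition lie_ideal ::
  "('k, 'r) ring_scheme \<Rightarrow> 'v set \<Rightarrow> ('k, 'v, 'm) lie_scheme \<Rightarrow> bool"
  where "lie_ideal K I L \<longleftrightarrow>
    subspace K I L \<and> (\<forall>x\<in>carrier L. \<forall>y\<in>I. bracket L x y \<in> I)"

definition completely_solvable ::
  "('k, 'r) ring_scheme \<Rightarrow> ('k, 'v, 'm) lie_scheme \<Rightarrow> bool"
  where "completely_solvable K L \<longleftrightarrow>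
    (\<exists>(n::nat) I. I 0 = {\<zero>\<^bsub>L\<^esub>} \<and> I n = carrier L
      \<and> (\<forall>j<n. I j \<subset> I (Suc j))
      \<and> (\<forall>j\<le>n. lie_ideal K (I j) L \<and> vectorspace.dim K (L\<lparr>carrier := I j\<rparr>) = j))"

definition perp ::
  "('k, 'r) ring_scheme \<Rightarrow> ('k, 'v, 'm) symplectic_lie_scheme \<Rightarrow> 'v set \<Rightarrow> 'v set"
  where "perp K S W = {v \<in> carrier S. \<forall>w\<in>W. form S v w = \<zero>\<^bsub>K\<^esub>}"

definition isotropic ::
  "('k, 'r) ring_scheme \<Rightarrow> ('k, 'v, 'm) symplectic_lie_scheme \<Rightarrow> 'v set \<Rightarrow> bool"
  where "isotropic K S W \<longleftrightarrow> subspace K W S \<and> W \<subseteq> perp K S W"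

text \<open>
  The quotient of the orthogonal complement of \<open>J\<close> by \<open>J\<close>: the elements are the cosets
  \<open>J +> v\<close> with \<open>v\<close> orthogonal to \<open>J\<close>, and all operations are induced by representatives.
  When \<open>J\<close> is an isotropic ideal the unions below are single cosets and the value of the
  form is the same for all representatives.
\<close>

definition symplectic_reduction ::
  "('k, 'r) ring_scheme \<Rightarrow> ('k, 'v, 'm) symplectic_lie_scheme \<Rightarrow> 'v set
    \<Rightarrow> ('k, 'v set) symplectic_lie"
  where "symplectic_reduction K S J =
    \<lparr>carrier = a_rcosets\<^bsub>S\<lparr>carrier := perp K S J\<rparr>\<^esub> J,
     mult = undefined,
     one = undefined,
     zero = J,
     add = set_add S,
     smult = (\<lambda>c A. \<Union>a\<in>A. J +>\<^bsub>S\<^esub> (c \<odot>\<^bsub>S\<^esub> a)),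
     bracket = (\<lambda>A B. \<Union>a\<in>A. \<Union>b\<in>B. J +>\<^bsub>S\<^esub> bracket S a b),
     form = (\<lambda>A B. THE c. \<exists>a\<in>A. \<exists>b\<in>B. c = form S a b)\<rparr>"

definition symplectic_iso ::
  "('k, 'r) ring_scheme \<Rightarrow> ('k, 'v, 'm) symplectic_lie_scheme
    \<Rightarrow> ('k, 'w, 'n) symplectic_lie_scheme \<Rightarrow> ('v \<Rightarrow> 'w) set"
  where "symplectic_iso K S T =
    {f \<in> module_hom K S T. bij_betw f (carrier S) (carrier T) \<and>
      (\<forall>x\<in>carrier S. \<forall>y\<in>carrier S.
        f (bracket S x y) = bracket T (f x) (f y) \<and> form T (f x) (f y) = form S x y)}"

text \<open>
  The quotient lives on the type \<open>'v set\<close>, so a chain of successive quotients has no common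
  type. The terms of such a chain are therefore taken up to isomorphism. Nothing is lost by
  keeping them all on the type \<open>'v\<close> of \<open>S\<close>, since choosing representatives of the cosets
  yields a copy of the quotient whose carrier is a subset of the carrier of \<open>S\<close>.
\<close>

definition is_symplectic_reduction_of ::
  "('k, 'r) ring_scheme \<Rightarrow> ('k, 'w, 'n) symplectic_lie_scheme
    \<Rightarrow> ('k, 'v, 'm) symplectic_lie_scheme \<Rightarrow> bool"
  where "is_symplectic_reduction_of K T S \<longleftrightarrow>
    (\<exists>J. lie_ideal K J S \<and> isotropic K S J \<and>
      symplectic_iso K (symplectic_reduction K S J) T \<noteq> {})"

definition completely_reducible ::
  "('k, 'r) ring_scheme \<Rightarrow> ('k, 'v) symplectic_lie \<Rightarrow> bool"
  where "completely_reducible K S \<longleftrightarrow>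
    (\<exists>(n::nat) (T :: nat \<Rightarrow> ('k, 'v) symplectic_lie). T 0 = S
      \<and> (\<forall>i\<le>n. symplectic_lie_algebra K (T i))
      \<and> (\<forall>i<n. is_symplectic_reduction_of K (T (Suc i)) (T i))
      \<and> carrier (T n) = {\<zero>\<^bsub>T n\<^esub>})"

end

theory Submission
  imports Defs
begin

text \<open>
  A flag of ideals supplies a one-dimensional, hence isotropic, ideal \<open>J = K e\<close>. Choosing
  \<open>y\<close> with \<open>\<omega>(e, y) = 1\<close>, the map \<open>v \<mapsto> v - \<omega>(v, y) e\<close> is a projection with kernel \<open>J\<close> which
  identifies \<open>J\<^sup>\<bottom>/J\<close> with the subspace \<open>{e, y}\<^sup>\<bottom>\<close>, carrying the projected bracket and the
  restricted form. The flag, intersected with \<open>J\<^sup>\<bottom>\<close> and projected, is again a chain of ideals,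
  now shorter by one, so induction on its length applies. Projection may collapse steps of the
  flag; the induction therefore runs over chains with steps of codimension at most one.
\<close>

section \<open>Linear algebra: subspaces and steps of codimension one\<close>

lemma (in abelian_group) add_diff_cancel_left:
  "\<lbrakk>a \<in> carrier G; b \<in> carrier G\<rbrakk> \<Longrightarrow> (a \<oplus> b) \<ominus> a = b"
  by (simp add: a_comm r_neg1 a_minus_def)

lemma (in abelian_group) diff_add_cancel:
  "\<lbrakk>a \<in> carrier G; b \<in> carrier G\<rbrakk> \<Longrightarrow> b \<oplus> (a \<ominus> b) = a"
  by (simp add: a_lcomm r_neg a_minus_def)

text \<open>Independent subsets of \<open>W\<close> remain independent in \<open>V\<close>, so their
  size is bounded by \<open>dim\<close>; a maximal one therefore exists and is a basis of
  \<open>W\<close>.\<close>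

lemma (in vectorspace) subspace_fin_dim:
  assumes "fin_dim" and W: "subspace K W V"
  shows "vectorspace.fin_dim K (vs W)"
proof -
  interpret W: vectorspace K "vs W" by (rule subspace_is_vs[OF W])
  have sub: "submodule K W V" using W by simp
  then have WV: "W \<subseteq> carrier V" by (simp add: submodule_def)
  have "\<exists>A. finite A \<and> maximal A (\<lambda>A. A \<subseteq> carrier (vs W) \<and> W.lin_indpt A)"
  proof (rule maximal_exists)
    show "finite A \<and> card A \<le> dim" if "A \<subseteq> carrier (vs W) \<and> W.lin_indpt A" for A
      using that li_le_dim[OF assms(1), of A] span_li_not_depend(2)[OF _ sub, of A] WV by auto
    show "{} \<subseteq> carrier (vs W) \<and> W.lin_indpt {}"
      by (auto simp: W.lin_dep_def)
  qed
  then obtain A where A: "finite A" "W.basis A"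
    using W.max_li_is_basis by blast
  then show ?thesis unfolding W.fin_dim_def W.basis_def by blast
qed

text \<open>A basis \<open>B\<close> of \<open>U\<close> enlarged by \<open>x\<close> is
  independent, and by the dimension bound it is large enough to be a basis of \<open>W\<close>. The
  scalar \<open>c\<close> is the coefficient of \<open>x\<close> in the expansion of
  \<open>b\<close>; what remains is a combination of \<open>B\<close>.\<close>

lemma (in vectorspace) subspace_codim_1:
  assumes fd: "fin_dim" and U: "subspace K U V" and W: "subspace K W V" and "U \<subseteq> W"
    and dim: "vectorspace.dim K (vs W) \<le> Suc (vectorspace.dim K (vs U))"
    and x: "x \<in> W" "x \<notin> U" and b: "b \<in> W"
  shows "\<exists>c\<in>carrier K. b \<ominus>\<^bsub>V\<^esub> c \<odot>\<^bsub>V\<^esub> x \<in> U"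
proof -
  interpret U: vectorspace K "vs U" by (rule subspace_is_vs[OF U])
  interpret W: vectorspace K "vs W" by (rule subspace_is_vs[OF W])
  have sU: "submodule K U V" and sW: "submodule K W V" using U W by simp_all
  then have WV: "W \<subseteq> carrier V" by (simp add: submodule_def)
  obtain B where B: "finite B" "U.basis B"
    using U.finite_basis_exists[OF subspace_fin_dim[OF fd U]] by blast
  then have BU: "B \<subseteq> U" "card B = U.dim" by (auto simp: U.basis_def U.dim_basis)
  have BV: "B \<subseteq> carrier V" "x \<in> carrier V" using BU WV \<open>U \<subseteq> W\<close> x by auto
  have spB: "span B = U" and liB: "lin_indpt B"
    using B span_li_not_depend[OF BU(1) sU] by (auto simp: U.basis_def)
  have xB: "x \<notin> B" using BU x by auto
  have "lin_indpt (insert x B)"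
    using lin_dep_iff_in_span[OF BV(1) liB BV(2) xB] x spB by simp
  moreover have BW: "insert x B \<subseteq> W" using BU x \<open>U \<subseteq> W\<close> by auto
  ultimately have "W.basis (insert x B)"
    using W.dim_li_is_basis[OF subspace_fin_dim[OF fd W], of "insert x B"]
      span_li_not_depend(2)[OF BW sW] dim B(1) xB BU by simp
  then have "b \<in> span (insert x B)"
    using b span_li_not_depend(1)[OF BW sW] by (simp add: W.basis_def)
  then obtain f where f: "f \<in> insert x B \<rightarrow> carrier K" "b = lincomb f (insert x B)"
    using finite_in_span[of "insert x B" b] B(1) BV by auto
  then have b_eq: "b = f x \<odot>\<^bsub>V\<^esub> x \<oplus>\<^bsub>V\<^esub> lincomb f B"
    using lincomb_insert2[OF B(1) BV(1) _ xB BV(2)] f by simp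
  have l: "lincomb f B \<in> span B" using f(1) B(1) unfolding span_def by blast
  then have "lincomb f B \<in> carrier V" using spB WV \<open>U \<subseteq> W\<close> by auto
  then have "b \<ominus>\<^bsub>V\<^esub> f x \<odot>\<^bsub>V\<^esub> x = lincomb f B"
    using f(1) BV(2) unfolding b_eq
    by (simp add: M.add_diff_cancel_left)
  then show ?thesis using l spB f(1) by force
qed

section \<open>Chains of ideals\<close>

text \<open>The last clause bounds the codimension of \<open>I j\<close> in \<open>I (Suc j)\<close>
  by one, repetitions being allowed. It is phrased with elements rather than dimensions so that it
  passes to intersections and linear images by computing with representatives.\<close>

definition codim_1_chain ::
  "('k, 'r) ring_scheme \<Rightarrow> ('k, 'v, 'm) lie_scheme \<Rightarrow> nat \<Rightarrow> (nat \<Rightarrow> 'v set) \<Rightarrow> bool"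
  where "codim_1_chain K L n I \<longleftrightarrow> I 0 = {\<zero>\<^bsub>L\<^esub>} \<and> I n = carrier L
    \<and> (\<forall>j\<le>n. lie_ideal K (I j) L)
    \<and> (\<forall>j<n. \<forall>x\<in>I (Suc j) - I j. \<forall>b\<in>I (Suc j). \<exists>c\<in>carrier K. b \<ominus>\<^bsub>L\<^esub> c \<odot>\<^bsub>L\<^esub> x \<in> I j)"

lemma (in lie_algebra) completely_solvable_imp_codim_1_chain:
  assumes "completely_solvable K L"
  shows "\<exists>n I. codim_1_chain K L n I"
proof -
  obtain n I where I: "I 0 = {\<zero>\<^bsub>L\<^esub>}" "I n = carrier L" "\<forall>j<n. I j \<subset> I (Suc j)"
    "\<forall>j\<le>n. lie_ideal K (I j) L \<and> vectorspace.dim K (L\<lparr>carrier := I j\<rparr>) = j"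
    using assms unfolding completely_solvable_def by blast
  have "\<exists>c\<in>carrier K. b \<ominus>\<^bsub>L\<^esub> c \<odot>\<^bsub>L\<^esub> x \<in> I j"
    if "j < n" "x \<in> I (Suc j) - I j" "b \<in> I (Suc j)" for j x b
    by (rule subspace_codim_1[OF finite_dimensional, of _ "I (Suc j)"])
      (use I that in \<open>auto simp: lie_ideal_def\<close>)
  then have "codim_1_chain K L n I" using I unfolding codim_1_chain_def by simp
  then show ?thesis by blast
qed

text \<open>The vector space axioms do not mention the bracket. This serves \<open>reduct\<close>
  below, which changes the bracket as well as the carrier.\<close>

lemma vectorspace_bracket_update:
  assumes "vectorspace K L"
  shows "vectorspace K (L\<lparr>bracket := b\<rparr>)"
proof -
  interpret vectorspace K L by fact
  show ?thesis
    by (rule vs_criteria) (use M.r_neg in \<open>auto intro!: M.a_ac smult_r_distr smult_l_distr smult_assoc1 simp: field_axioms\<close>)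
qed

section \<open>Elementary consequences of the axioms\<close>

context symplectic_lie_algebra begin

lemma form_zero_left: "x \<in> carrier S \<Longrightarrow> form S \<zero>\<^bsub>S\<^esub> x = \<zero>\<^bsub>K\<^esub>"
  using form_smult_left[of "\<zero>\<^bsub>K\<^esub>" x x] by (simp add: form_closed)

lemma form_skew:
  assumes "a \<in> carrier S" "b \<in> carrier S"
  shows "form S a b = \<ominus>\<^bsub>K\<^esub> form S b a"
proof -
  have "form S a b \<oplus>\<^bsub>K\<^esub> form S b a = \<zero>\<^bsub>K\<^esub>"
    using assms form_alternating[of "b \<oplus>\<^bsub>S\<^esub> a"] form_alternating[of a] form_alternating[of b]
    by (simp add: form_add_left form_add_right form_closed)
  then show ?thesis using assms by (simp add: form_closed R.minus_equality[of "form S a b" "form S b a"])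
qed

lemma bracket_skew:
  assumes "a \<in> carrier S" "b \<in> carrier S"
  shows "bracket S a b = \<ominus>\<^bsub>S\<^esub> bracket S b a"
proof -
  have "bracket S a b \<oplus>\<^bsub>S\<^esub> bracket S b a = \<zero>\<^bsub>S\<^esub>"
    using assms bracket_self[of "b \<oplus>\<^bsub>S\<^esub> a"] bracket_self[of a] bracket_self[of b]
    by (simp add: bracket_add_left bracket_add_right bracket_closed)
  then show ?thesis using assms by (simp add: bracket_closed M.minus_equality[of "bracket S a b" "bracket S b a"])
qed

lemma form_minus_left:
  assumes "a \<in> carrier S" "b \<in> carrier S" "c \<in> carrier S"
  shows "form S (a \<ominus>\<^bsub>S\<^esub> b) c = form S a c \<ominus>\<^bsub>K\<^esub> form S b c"
  using form_smult_left[of "\<ominus>\<^bsub>K\<^esub> \<one>\<^bsub>K\<^esub>" b c] assms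
  by (simp add: a_minus_def form_add_left form_closed smult_minus_1 R.l_minus)

lemma subspace_perp:
  assumes "W \<subseteq> carrier S"
  shows "subspace K (perp K S W) S"
proof (intro subspace.intro submodule.intro)
  show "vectorspace K S" "module K S" by unfold_locales
qed (use assms in \<open>auto simp: perp_def form_add_left form_smult_left form_zero_left subset_iff\<close>)

text \<open>With \<open>mem_perp_empty\<close>, this turns membership in the complement of an
  explicit finite set into one equation per element.\<close>

lemma mem_perp_insert: "v \<in> perp K S (insert w W) \<longleftrightarrow> v \<in> perp K S W \<and> form S v w = \<zero>\<^bsub>K\<^esub>"
  by (auto simp: perp_def)

lemma mem_perp_empty: "v \<in> perp K S {} \<longleftrightarrow> v \<in> carrier S"
  by (simp add: perp_def)

lemmas mem_perp = mem_perp_insert mem_perp_empty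

end

section \<open>The projection along a one-dimensional ideal\<close>

text \<open>\<open>bracket_e\<close> makes the span of \<open>e\<close> an ideal. The normalisation
  \<open>form_e_y\<close> also forces \<open>e\<close> to be nonzero and makes \<open>proj\<close>
  below annihilate \<open>e\<close>.\<close>

locale symplectic_lie_line = symplectic_lie_algebra K S
  for K :: "('k, 'r) ring_scheme" and S :: "('k, 'v, 'm) symplectic_lie_scheme" +
  fixes e y
  assumes e_closed [simp]: "e \<in> carrier S" and y_closed [simp]: "y \<in> carrier S"
    and bracket_e: "x \<in> carrier S \<Longrightarrow> \<exists>c\<in>carrier K. bracket S x e = c \<odot>\<^bsub>S\<^esub> e"
    and form_e_y [simp]: "form S e y = \<one>\<^bsub>K\<^esub>"
begin

declare form_closed [simp] bracket_closed [simp] form_alternating [simp] bracket_self [simp]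

definition proj :: "'v \<Rightarrow> 'v"
  where "proj v = v \<ominus>\<^bsub>S\<^esub> form S v y \<odot>\<^bsub>S\<^esub> e"

lemma proj_closed [simp]: "a \<in> carrier S \<Longrightarrow> proj a \<in> carrier S"
  by (simp add: proj_def)

sublocale proj: linear_map K S S proj
proof (unfold_locales, unfold module_hom_def, safe)
  show "proj a \<in> carrier S" if "a \<in> carrier S" for a
    using that by (simp add: proj_def)
  show "proj (a \<oplus>\<^bsub>S\<^esub> b) = proj a \<oplus>\<^bsub>S\<^esub> proj b" if "a \<in> carrier S" "b \<in> carrier S" for a b
    using that by (simp add: proj_def form_add_left smult_l_distr a_minus_def M.minus_add)
      (simp add: M.add.m_assoc M.add.m_lcomm)
  show "proj (c \<odot>\<^bsub>S\<^esub> a) = c \<odot>\<^bsub>S\<^esub> proj a" if "c \<in> carrier K" "a \<in> carrier S" for c a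
    using that by (simp add: proj_def form_smult_left smult_assoc1 a_minus_def smult_r_distr smult_r_minus)
qed

lemma proj_e [simp]: "proj e = \<zero>\<^bsub>S\<^esub>"
  by (simp add: proj_def a_minus_def M.r_neg)

text \<open>\<open>proj\<close> alters \<open>a\<close> by a multiple of \<open>e\<close>, which a
  vector orthogonal to \<open>e\<close> does not see.\<close>

lemma form_proj_left:
  "\<lbrakk>a \<in> carrier S; b \<in> carrier S; form S e b = \<zero>\<^bsub>K\<^esub>\<rbrakk> \<Longrightarrow> form S (proj a) b = form S a b"
  by (simp add: proj_def form_minus_left form_smult_left)
    (simp add: a_minus_def)

lemma form_proj_right:
  "\<lbrakk>a \<in> carrier S; b \<in> carrier S; form S a e = \<zero>\<^bsub>K\<^esub>\<rbrakk> \<Longrightarrow> form S a (proj b) = form S a b"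
  using form_proj_left[of b a] form_skew[of a b] form_skew[of a "proj b"] form_skew[of e a] by simp

lemma form_proj_e [simp]: "a \<in> carrier S \<Longrightarrow> form S (proj a) e = form S a e"
  by (simp add: form_proj_left)

lemma form_proj_y [simp]: "a \<in> carrier S \<Longrightarrow> form S (proj a) y = \<zero>\<^bsub>K\<^esub>"
  by (simp add: proj_def form_minus_left form_smult_left)

lemma proj_id: "\<lbrakk>a \<in> carrier S; form S a y = \<zero>\<^bsub>K\<^esub>\<rbrakk> \<Longrightarrow> proj a = a"
  by (simp add: proj_def a_minus_def)

text \<open>Replacing \<open>b\<close> by \<open>proj b\<close> changes the bracket by a multiple of
  \<open>bracket S a e\<close>, hence of \<open>e\<close>, and \<open>proj\<close> kills that. So
  the bracket is well defined modulo \<open>e\<close>.\<close>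

lemma proj_bracket_right [simp]:
  assumes "a \<in> carrier S" "b \<in> carrier S"
  shows "proj (bracket S a (proj b)) = proj (bracket S a b)"
proof -
  obtain c where c: "c \<in> carrier K" "bracket S a e = c \<odot>\<^bsub>S\<^esub> e"
    using bracket_e assms by blast
  have "proj b = b \<oplus>\<^bsub>S\<^esub> (\<ominus>\<^bsub>K\<^esub> form S b y) \<odot>\<^bsub>S\<^esub> e"
    using assms by (simp add: proj_def a_minus_def smult_l_minus)
  then show ?thesis using c assms
    by (simp add: bracket_add_right bracket_smult_right)
qed

lemma proj_bracket_left [simp]:
  assumes "a \<in> carrier S" "b \<in> carrier S"
  shows "proj (bracket S (proj a) b) = proj (bracket S a b)"
  using proj_bracket_right[OF assms(2,1)] bracket_skew[of a b] bracket_skew[of "proj a" b] assms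
  by simp

text \<open>The complement of \<open>e\<close> is a subalgebra: in the cocycle identity for
  \<open>a\<close>, \<open>b\<close>, \<open>e\<close>, the brackets with \<open>e\<close> are
  multiples of \<open>e\<close>, so their terms vanish by orthogonality and only the desired one is
  left.\<close>

lemma form_bracket_e:
  assumes "a \<in> carrier S" "b \<in> carrier S" "form S a e = \<zero>\<^bsub>K\<^esub>" "form S b e = \<zero>\<^bsub>K\<^esub>"
  shows "form S (bracket S a b) e = \<zero>\<^bsub>K\<^esub>"
proof -
  obtain c d where c: "c \<in> carrier K" "bracket S a e = c \<odot>\<^bsub>S\<^esub> e"
     "d \<in> carrier K" "bracket S b e = d \<odot>\<^bsub>S\<^esub> e"
    using bracket_e assms by blast
  have e: "form S e a = \<zero>\<^bsub>K\<^esub>" "form S e b = \<zero>\<^bsub>K\<^esub>"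
    using assms form_skew[of e a] form_skew[of e b] by simp_all
  have "bracket S e a = \<ominus>\<^bsub>S\<^esub> (c \<odot>\<^bsub>S\<^esub> e)"
    using assms c bracket_skew[of e a] by simp
  also have "\<dots> = (\<ominus>\<^bsub>K\<^esub> c) \<odot>\<^bsub>S\<^esub> e"
    using c by (simp add: smult_l_minus)
  finally have "bracket S e a = (\<ominus>\<^bsub>K\<^esub> c) \<odot>\<^bsub>S\<^esub> e" .
  then show ?thesis using assms c e form_closed_cocycle[of a b e]
    by (simp add: form_smult_left)
qed

section \<open>A model of the reduction inside the original space\<close>

text \<open>The carrier is a complement of the span of \<open>e\<close> in
  \<open>perp K S {e}\<close>, so every coset has one representative there and the type stays
  \<open>'v\<close>. Brackets inherit orthogonality to \<open>e\<close> only; projecting them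
  restores orthogonality to \<open>y\<close>.\<close>

definition reduct :: "('k, 'v, 'm) symplectic_lie_scheme"
  where "reduct = S\<lparr>carrier := perp K S {e, y}, bracket := \<lambda>a b. proj (bracket S a b)\<rparr>"

lemma reduct_simps [simp]:
  "carrier reduct = perp K S {e, y}" "zero reduct = zero S" "add reduct = add S"
  "smult reduct = smult S" "bracket reduct = (\<lambda>a b. proj (bracket S a b))" "form reduct = form S"
  by (simp_all add: reduct_def)

lemma proj_perp_eq: "proj ` perp K S {e} = perp K S {e, y}"
proof
  show "perp K S {e, y} \<subseteq> proj ` perp K S {e}"
    using proj_id by (force simp: mem_perp image_iff)
qed (auto simp: mem_perp)

lemma vectorspace_reduct: "vectorspace K reduct"
proof -
  have "vectorspace K (S\<lparr>carrier := perp K S {e, y}\<rparr>)"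
    by (intro subspace_is_vs subspace_perp) simp
  from vectorspace_bracket_update[OF this] show ?thesis by (simp add: reduct_def)
qed

text \<open>The plain subspace \<open>W\<close> and \<open>reduct\<close> differ only in their
  brackets, so the identity is a surjective linear map between them and transports finite
  dimension.\<close>

lemma fin_dim_reduct: "vectorspace.fin_dim K reduct"
proof -
  define W where "W = S\<lparr>carrier := perp K S {e, y}\<rparr>"
  have sub: "subspace K (perp K S {e, y}) S" by (intro subspace_perp) simp
  interpret W: vectorspace K W unfolding W_def by (intro subspace_is_vs sub)
  interpret R: vectorspace K reduct by (rule vectorspace_reduct)
  interpret id: linear_map K W reduct "\<lambda>x. x"
    by unfold_locales (simp add: module_hom_def W_def)
  show ?thesis
    using id.surj_fin_dim subspace_fin_dim[OF finite_dimensional sub] by (simp add: W_def)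
qed

lemma lie_algebra_reduct: "lie_algebra K reduct"
proof (intro lie_algebra.intro lie_algebra_axioms.intro)
  show "\<And>n::nat. n > 0 \<Longrightarrow> [n] \<cdot>\<^bsub>K\<^esub> \<one>\<^bsub>K\<^esub> \<noteq> \<zero>\<^bsub>K\<^esub>" by (rule char_0)
  show "bracket reduct a (bracket reduct b c) \<oplus>\<^bsub>reduct\<^esub> bracket reduct b (bracket reduct c a)
      \<oplus>\<^bsub>reduct\<^esub> bracket reduct c (bracket reduct a b) = \<zero>\<^bsub>reduct\<^esub>"
    if "a \<in> carrier reduct" "b \<in> carrier reduct" "c \<in> carrier reduct" for a b c
    \<comment> \<open>The Jacobi identity of \<open>S\<close> is projected; the inner projections
      disappear by \<open>proj_bracket_right\<close>.\<close>
    using that arg_cong[OF jacobi[of a b c], of proj] by (simp add: mem_perp)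
qed (simp_all add: vectorspace_reduct fin_dim_reduct mem_perp form_bracket_e bracket_add_left bracket_add_right
  bracket_smult_left bracket_smult_right)

lemma form_e_left: "\<lbrakk>a \<in> carrier S; form S a e = \<zero>\<^bsub>K\<^esub>\<rbrakk> \<Longrightarrow> form S e a = \<zero>\<^bsub>K\<^esub>"
  using form_skew[of e a] by simp

lemma proj_decomp: "a \<in> carrier S \<Longrightarrow> a = form S a y \<odot>\<^bsub>S\<^esub> e \<oplus>\<^bsub>S\<^esub> proj a"
  by (simp add: proj_def M.diff_add_cancel)

text \<open>\<open>e\<close> and \<open>y\<close> span a hyperbolic plane, and the space is its sum
  with the orthogonal complement. Subtracting a multiple of \<open>y\<close> gives \<open>t\<close>
  orthogonal to \<open>e\<close>; projecting \<open>t\<close> then splits off the multiple of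
  \<open>e\<close>.\<close>

lemma perp_decomp:
  assumes "s \<in> carrier S"
  obtains b c z where "b \<in> carrier K" "c \<in> carrier K" "z \<in> perp K S {e, y}"
    "s = b \<odot>\<^bsub>S\<^esub> y \<oplus>\<^bsub>S\<^esub> (c \<odot>\<^bsub>S\<^esub> e \<oplus>\<^bsub>S\<^esub> z)"
proof -
  define t where "t = s \<ominus>\<^bsub>S\<^esub> form S e s \<odot>\<^bsub>S\<^esub> y"
  have t: "t \<in> carrier S" using assms by (simp add: t_def)
  have "form S s e = \<ominus>\<^bsub>K\<^esub> form S e s" "form S y e = \<ominus>\<^bsub>K\<^esub> \<one>\<^bsub>K\<^esub>"
    using assms form_skew[of s e] form_skew[of y e] by simp_all
  then have "form S t e = \<zero>\<^bsub>K\<^esub>"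
    using assms by (simp add: t_def form_minus_left form_smult_left R.r_minus)
  then have "proj t \<in> perp K S {e, y}" using t by (simp add: mem_perp)
  moreover have "form S e s \<odot>\<^bsub>S\<^esub> y \<oplus>\<^bsub>S\<^esub> t = s"
    using assms by (simp add: t_def M.diff_add_cancel)
  then have "s = form S e s \<odot>\<^bsub>S\<^esub> y \<oplus>\<^bsub>S\<^esub> (form S t y \<odot>\<^bsub>S\<^esub> e \<oplus>\<^bsub>S\<^esub> proj t)"
    by (simp only: proj_decomp[OF t, symmetric])
  ultimately show ?thesis using that assms t form_closed e_closed y_closed by blast
qed

lemma symplectic_lie_algebra_reduct: "symplectic_lie_algebra K reduct"
proof (rule symplectic_lie_algebra.intro, rule lie_algebra_reduct, rule symplectic_lie_algebra_axioms.intro)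
  show "x = \<zero>\<^bsub>reduct\<^esub>" if x: "x \<in> carrier reduct"
    and 0: "\<And>z. z \<in> carrier reduct \<Longrightarrow> form reduct x z = \<zero>\<^bsub>K\<^esub>" for x
  proof -
    have "x = \<zero>\<^bsub>S\<^esub>"
    proof (rule form_nondegenerate)
      fix s assume s: "s \<in> carrier S"
      from perp_decomp[OF s] obtain b c z where z: "b \<in> carrier K" "c \<in> carrier K" "z \<in> perp K S {e, y}"
        and s: "s = b \<odot>\<^bsub>S\<^esub> y \<oplus>\<^bsub>S\<^esub> (c \<odot>\<^bsub>S\<^esub> e \<oplus>\<^bsub>S\<^esub> z)" .
      have "z \<in> carrier S" using z by (simp add: mem_perp)
      \<comment> \<open>Being in the carrier, \<open>x\<close> is orthogonal to \<open>e\<close> and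
        \<open>y\<close>; it is orthogonal to \<open>z\<close> by assumption. Hence nondegeneracy
        descends from \<open>S\<close>.\<close>
      then show "form S x s = \<zero>\<^bsub>K\<^esub>"
        using z x 0[of z] by (simp add: s mem_perp form_add_right form_smult_right form_e_left)
    qed (use x in \<open>simp add: mem_perp\<close>)
    then show ?thesis by simp
  qed
  show "form reduct (bracket reduct u v) w \<oplus>\<^bsub>K\<^esub> form reduct (bracket reduct w u) v
      \<oplus>\<^bsub>K\<^esub> form reduct (bracket reduct v w) u = \<zero>\<^bsub>K\<^esub>"
    if "u \<in> carrier reduct" "v \<in> carrier reduct" "w \<in> carrier reduct" for u v w
    \<comment> \<open>Each projected bracket is paired with a vector orthogonal to \<open>e\<close>,
      so \<open>form_proj_left\<close> reduces the identity to that of \<open>S\<close>.\<close>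
    using that form_closed_cocycle[of u v w] by (simp add: mem_perp form_proj_left form_e_left)
qed (simp_all add: mem_perp form_add_left form_add_right form_smult_left form_smult_right)

section \<open>Identification of the model with the coset quotient\<close>

definition line :: "'v set"
  where "line = {c \<odot>\<^bsub>S\<^esub> e | c. c \<in> carrier K}"

text \<open>The kernel of \<open>proj\<close> is the span of \<open>e\<close>. By
  \<open>proj_decomp\<close>, vectors with equal projections differ only in their
  \<open>e\<close>-components, which gives \<open>c\<close> as a difference of pairings with
  \<open>y\<close>.\<close>

lemma proj_eq_iff:
  assumes "a \<in> carrier S" "b \<in> carrier S"
  shows "proj a = proj b \<longleftrightarrow> (\<exists>c\<in>carrier K. a = c \<odot>\<^bsub>S\<^esub> e \<oplus>\<^bsub>S\<^esub> b)"
proof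
  assume eq: "proj a = proj b"
  have a: "a = form S a y \<odot>\<^bsub>S\<^esub> e \<oplus>\<^bsub>S\<^esub> proj a" and b: "b = form S b y \<odot>\<^bsub>S\<^esub> e \<oplus>\<^bsub>S\<^esub> proj b"
    using assms by (auto intro: proj_decomp)
  have "(form S a y \<ominus>\<^bsub>K\<^esub> form S b y) \<odot>\<^bsub>S\<^esub> e \<oplus>\<^bsub>S\<^esub> (form S b y \<odot>\<^bsub>S\<^esub> e \<oplus>\<^bsub>S\<^esub> proj b)
      = ((form S a y \<ominus>\<^bsub>K\<^esub> form S b y) \<oplus>\<^bsub>K\<^esub> form S b y) \<odot>\<^bsub>S\<^esub> e \<oplus>\<^bsub>S\<^esub> proj b"
    using assms by (simp add: smult_l_distr M.a_assoc)
  also have "\<dots> = form S a y \<odot>\<^bsub>S\<^esub> e \<oplus>\<^bsub>S\<^esub> proj a"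
    using assms eq by (simp add: a_minus_def R.a_assoc R.l_neg)
  finally have "a = (form S a y \<ominus>\<^bsub>K\<^esub> form S b y) \<odot>\<^bsub>S\<^esub> e \<oplus>\<^bsub>S\<^esub> b"
    by (simp only: a[symmetric] b[symmetric])
  then show "\<exists>c\<in>carrier K. a = c \<odot>\<^bsub>S\<^esub> e \<oplus>\<^bsub>S\<^esub> b"
    by (rule bexI) (use assms in simp)
qed (use assms in auto)

lemma coset_eq: "w \<in> carrier S \<Longrightarrow> line +>\<^bsub>S\<^esub> w = {s \<in> carrier S. proj s = proj w}"
  by (auto simp: a_r_coset_def' line_def proj_eq_iff) blast

lemma line_ideal: "lie_ideal K line S"
  unfolding lie_ideal_def
proof (intro conjI ballI subspace.intro submodule.intro)
  show "vectorspace K S" "module K S" by unfold_locales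
  show "line \<subseteq> carrier S" by (auto simp: line_def)
  show "a \<oplus>\<^bsub>S\<^esub> b \<in> line" if "a \<in> line" "b \<in> line" for a b
    using that by (auto simp: line_def smult_l_distr[symmetric])
  show "\<zero>\<^bsub>S\<^esub> \<in> line"
    unfolding line_def by (rule CollectI, rule exI[of _ "\<zero>\<^bsub>K\<^esub>"]) simp
  show "c \<odot>\<^bsub>S\<^esub> a \<in> line" if "c \<in> carrier K" "a \<in> line" for c a
    using that by (auto simp: line_def smult_assoc1[symmetric])
  show "bracket S x a \<in> line" if x: "x \<in> carrier S" and a: "a \<in> line" for x a
  proof -
    obtain c d where "a = c \<odot>\<^bsub>S\<^esub> e" "c \<in> carrier K" "bracket S x e = d \<odot>\<^bsub>S\<^esub> e" "d \<in> carrier K"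
      using a bracket_e[OF x] unfolding line_def by blast
    then have "bracket S x a = (c \<otimes>\<^bsub>K\<^esub> d) \<odot>\<^bsub>S\<^esub> e" "c \<otimes>\<^bsub>K\<^esub> d \<in> carrier K"
      using x by (simp_all add: bracket_smult_right smult_assoc1)
    then show ?thesis unfolding line_def by blast
  qed
qed

lemma perp_line: "perp K S line = perp K S {e}"
proof
  have "e \<in> line" unfolding line_def by (rule CollectI, rule exI[of _ "\<one>\<^bsub>K\<^esub>"]) simp
  then show "perp K S line \<subseteq> perp K S {e}" by (auto simp: perp_def)
qed (auto simp: perp_def line_def form_smult_right)

lemma isotropic_line: "isotropic K S line"
proof -
  have "line \<subseteq> perp K S {e}" by (auto simp: line_def mem_perp form_smult_left)
  then show ?thesis using line_ideal by (simp add: isotropic_def lie_ideal_def perp_line)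
qed

text \<open>By \<open>coset_eq\<close> this is the coset of \<open>line\<close> through
  \<open>w\<close>; as a fibre of \<open>proj\<close> it lets equality of cosets be tested by
  equality of projections.\<close>

definition fibre :: "'v \<Rightarrow> 'v set"
  where "fibre w = {s \<in> carrier S. proj s = proj w}"

lemma fibre_eq_iff: "w \<in> carrier S \<Longrightarrow> v \<in> carrier S \<Longrightarrow> fibre w = fibre v \<longleftrightarrow> proj w = proj v"
  by (auto simp: fibre_def)

abbreviation quotient :: "('k, 'v set) symplectic_lie"
  where "quotient \<equiv> symplectic_reduction K S line"

lemma carrier_quotient: "carrier quotient = fibre ` perp K S {e}"
proof -
  have "line +>\<^bsub>S\<lparr>carrier := perp K S {e}\<rparr>\<^esub> w = line +>\<^bsub>S\<^esub> w" for w
    by (simp add: a_r_coset_def')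
  then show ?thesis
    by (auto simp: symplectic_reduction_def A_RCOSETS_def' perp_line coset_eq fibre_def mem_perp image_iff)
qed

lemma add_quotient:
  assumes "v \<in> carrier S" "w \<in> carrier S"
  shows "fibre v \<oplus>\<^bsub>quotient\<^esub> fibre w = fibre (v \<oplus>\<^bsub>S\<^esub> w)"
proof -
  have "s \<in> fibre v <+>\<^bsub>S\<^esub> fibre w" if s: "s \<in> carrier S" "proj s = proj v \<oplus>\<^bsub>S\<^esub> proj w" for s
  proof -
    \<comment> \<open>To write \<open>s\<close> as a sum of members of the two cosets,
      \<open>v\<close> itself is kept as the first summand and the rest is put into the
      second.\<close>
    have "s \<ominus>\<^bsub>S\<^esub> v \<in> fibre w"
      using assms s by (simp add: fibre_def M.add_diff_cancel_left)
    moreover have "s = v \<oplus>\<^bsub>S\<^esub> (s \<ominus>\<^bsub>S\<^esub> v)"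
      using assms s by (simp add: M.diff_add_cancel)
    moreover have "v \<in> fibre v" using assms by (simp add: fibre_def)
    ultimately show ?thesis unfolding set_add_def' by blast
  qed
  then show ?thesis using assms
    by (auto simp: symplectic_reduction_def fibre_def set_add_def')
qed

lemma smult_quotient:
  assumes "c \<in> carrier K" "v \<in> carrier S"
  shows "c \<odot>\<^bsub>quotient\<^esub> fibre v = fibre (c \<odot>\<^bsub>S\<^esub> v)"
proof -
  have "line +>\<^bsub>S\<^esub> (c \<odot>\<^bsub>S\<^esub> a) = fibre (c \<odot>\<^bsub>S\<^esub> v)" if "a \<in> fibre v" for a
    using that assms by (simp add: fibre_def coset_eq)
  moreover have "v \<in> fibre v" using assms by (simp add: fibre_def)
  ultimately show ?thesis by (auto simp: symplectic_reduction_def)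
qed

lemma bracket_quotient:
  assumes "v \<in> carrier S" "w \<in> carrier S"
  shows "bracket quotient (fibre v) (fibre w) = fibre (bracket S v w)"
proof -
  \<comment> \<open>All members of the double union in the quotient bracket are this one coset, so
    the union collapses.\<close>
  have "line +>\<^bsub>S\<^esub> (bracket S a b) = fibre (bracket S v w)" if "a \<in> fibre v" "b \<in> fibre w" for a b
  proof -
    have ab: "a \<in> carrier S" "b \<in> carrier S" "proj a = proj v" "proj b = proj w"
      using that by (simp_all add: fibre_def)
    have "proj (bracket S a b) = proj (bracket S (proj a) (proj b))" using ab(1,2) by simp
    also have "\<dots> = proj (bracket S v w)" using assms by (simp add: ab(3,4))
    finally show ?thesis using ab(1,2) by (simp add: fibre_def coset_eq)
  qed
  moreover have "v \<in> fibre v" "w \<in> fibre w" using assms by (simp_all add: fibre_def)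
  ultimately show ?thesis by (auto simp: symplectic_reduction_def)
qed

lemma form_proj_proj:
  assumes "v \<in> perp K S {e}" "w \<in> perp K S {e}"
  shows "form S (proj v) (proj w) = form S v w"
  using assms by (simp add: mem_perp form_proj_left form_proj_right form_e_left)

text \<open>Any representatives \<open>a\<close>, \<open>b\<close> are again orthogonal to
  \<open>e\<close> and have the projections of \<open>v\<close>, \<open>w\<close>; by
  \<open>form_proj_proj\<close> their pairing has a single value, which is what the definite
  description needs.\<close>

lemma form_quotient:
  assumes "v \<in> perp K S {e}" "w \<in> perp K S {e}"
  shows "form quotient (fibre v) (fibre w) = form S v w"
proof -
  have eq: "form S a b = form S v w" if "a \<in> fibre v" "b \<in> fibre w" for a b
  proof -
    have ab: "a \<in> carrier S" "b \<in> carrier S" "proj a = proj v" "proj b = proj w"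
      using that by (simp_all add: fibre_def)
    have "form S a e = form S (proj a) e" "form S b e = form S (proj b) e"
      using ab(1,2) by simp_all
    then have "a \<in> perp K S {e}" "b \<in> perp K S {e}"
      using assms ab by (simp_all add: mem_perp)
    then show ?thesis using form_proj_proj assms ab(3,4) by metis
  qed
  moreover have "v \<in> fibre v" "w \<in> fibre w" using assms by (simp_all add: fibre_def mem_perp)
  ultimately have "(THE c. \<exists>a\<in>fibre v. \<exists>b\<in>fibre w. c = form S a b) = form S v w"
    by (intro the_equality) blast+
  then show ?thesis by (simp add: symplectic_reduction_def)
qed

lemma proj_fibre: "w \<in> carrier S \<Longrightarrow> proj ` fibre w = {proj w}"
  by (auto simp: fibre_def)

lemma reduct_is_reduction: "is_symplectic_reduction_of K reduct S"
proof -
  \<comment> \<open>\<open>proj\<close> is constant on each coset, so \<open>f\<close> picks that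
    common value; this is the isomorphism from the quotient to \<open>reduct\<close>.\<close>
  define f where "f A = the_elem (proj ` A)" for A
  have f: "f (fibre w) = proj w" if "w \<in> carrier S" for w
    using that by (simp add: f_def proj_fibre)
  have perp: "perp K S {e} \<subseteq> carrier S" by (auto simp: mem_perp)
  have closed: "c \<odot>\<^bsub>S\<^esub> v \<in> perp K S {e}" "v \<oplus>\<^bsub>S\<^esub> w \<in> perp K S {e}" "bracket S v w \<in> perp K S {e}"
    if "c \<in> carrier K" "v \<in> perp K S {e}" "w \<in> perp K S {e}" for c v w
    using that by (simp_all add: mem_perp form_smult_left form_add_left form_bracket_e)
  have "f \<in> module_hom K quotient reduct"
    unfolding module_hom_def carrier_quotient
    using perp proj_perp_eq by (auto simp: f add_quotient smult_quotient subset_iff)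
  moreover have "bij_betw f (carrier quotient) (carrier reduct)"
    unfolding bij_betw_def carrier_quotient
  proof
    show "inj_on f (fibre ` perp K S {e})"
      using perp by (auto simp: inj_on_def f fibre_eq_iff subset_iff)
    have "f ` fibre ` perp K S {e} = proj ` perp K S {e}"
      unfolding image_image using perp f by (intro image_cong) auto
    then show "f ` fibre ` perp K S {e} = carrier reduct" by (simp add: proj_perp_eq)
  qed
  moreover have "f (bracket quotient A B) = bracket reduct (f A) (f B)"
      "form reduct (f A) (f B) = form quotient A B"
    if AB: "A \<in> carrier quotient" "B \<in> carrier quotient" for A B
  proof -
    obtain v w where vw: "v \<in> perp K S {e}" "w \<in> perp K S {e}" "A = fibre v" "B = fibre w"
      using AB unfolding carrier_quotient by blast
    then have "v \<in> carrier S" "w \<in> carrier S" using perp by auto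
    then show "f (bracket quotient A B) = bracket reduct (f A) (f B)"
        "form reduct (f A) (f B) = form quotient A B"
      using vw by (simp_all add: f bracket_quotient form_quotient form_proj_proj)
  qed
  ultimately have "f \<in> symplectic_iso K quotient reduct"
    unfolding symplectic_iso_def by blast
  then show ?thesis
    unfolding is_symplectic_reduction_of_def using line_ideal isotropic_line by blast
qed

section \<open>Passing the chain of ideals to the reduction\<close>

text \<open>The indices shift by one because \<open>I 1\<close> is \<open>line\<close>, which
  projects to zero and so becomes the bottom of the new chain. The ideal and codimension properties
  are checked on preimages under \<open>proj\<close>.\<close>

lemma reduct_chain:
  assumes chain: "codim_1_chain K S (Suc n) I" and I1: "I 1 = line"
  shows "codim_1_chain K reduct n (\<lambda>j. proj ` (I (Suc j) \<inter> perp K S {e}))"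
  unfolding codim_1_chain_def
proof (intro conjI allI impI ballI)
  have I: "lie_ideal K (I (Suc j)) S" if "j \<le> n" for j
    using chain that by (simp add: codim_1_chain_def)
  have sub: "I (Suc j) \<subseteq> carrier S" "\<zero>\<^bsub>S\<^esub> \<in> I (Suc j)"
    "\<And>a b. a \<in> I (Suc j) \<Longrightarrow> b \<in> I (Suc j) \<Longrightarrow> a \<oplus>\<^bsub>S\<^esub> b \<in> I (Suc j)"
    "\<And>c a. c \<in> carrier K \<Longrightarrow> a \<in> I (Suc j) \<Longrightarrow> c \<odot>\<^bsub>S\<^esub> a \<in> I (Suc j)"
    "\<And>x a. x \<in> carrier S \<Longrightarrow> a \<in> I (Suc j) \<Longrightarrow> bracket S x a \<in> I (Suc j)"
    if "j \<le> n" for j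
    using I[OF that] unfolding lie_ideal_def subspace_def submodule_def by blast+
  have "proj a = \<zero>\<^bsub>S\<^esub>" if "a \<in> line" for a
    using that by (auto simp: line_def)
  moreover have "\<zero>\<^bsub>S\<^esub> \<in> I 1 \<inter> perp K S {e}"
    using sub(2)[of 0] by (simp add: mem_perp form_zero_left)
  ultimately show "proj ` (I (Suc 0) \<inter> perp K S {e}) = {\<zero>\<^bsub>reduct\<^esub>}"
    using I1 by (force simp: image_iff)
  have "I (Suc n) = carrier S" using chain by (simp add: codim_1_chain_def)
  moreover have "carrier S \<inter> perp K S {e} = perp K S {e}" by (auto simp: mem_perp)
  ultimately show "proj ` (I (Suc n) \<inter> perp K S {e}) = carrier reduct"
    by (simp add: proj_perp_eq)
  show "lie_ideal K (proj ` (I (Suc j) \<inter> perp K S {e})) reduct" (is "lie_ideal K ?J reduct")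
    if "j \<le> n" for j
    unfolding lie_ideal_def
  proof (intro conjI ballI subspace.intro submodule.intro)
    show "vectorspace K reduct" by (rule vectorspace_reduct)
    then show "module K reduct" by (simp add: vectorspace_def)
    show "?J \<subseteq> carrier reduct" using proj_perp_eq by auto
    show "a \<oplus>\<^bsub>reduct\<^esub> b \<in> ?J" if ab: "a \<in> ?J" "b \<in> ?J" for a b
    proof -
      obtain a' b' where ab': "a' \<in> I (Suc j) \<inter> perp K S {e}" "b' \<in> I (Suc j) \<inter> perp K S {e}"
          "a = proj a'" "b = proj b'"
        using ab by blast
      then have "a' \<oplus>\<^bsub>S\<^esub> b' \<in> I (Suc j) \<inter> perp K S {e}" "proj (a' \<oplus>\<^bsub>S\<^esub> b') = a \<oplus>\<^bsub>S\<^esub> b"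
        using sub(3)[OF \<open>j \<le> n\<close>] by (simp_all add: mem_perp form_add_left)
      then show ?thesis by (metis image_eqI reduct_simps(3))
    qed
    show "\<zero>\<^bsub>reduct\<^esub> \<in> ?J"
    proof (rule image_eqI)
      show "\<zero>\<^bsub>S\<^esub> \<in> I (Suc j) \<inter> perp K S {e}"
        using sub(2)[OF \<open>j \<le> n\<close>] by (simp add: mem_perp form_zero_left)
    qed simp
    show "c \<odot>\<^bsub>reduct\<^esub> a \<in> ?J" if ca: "c \<in> carrier K" "a \<in> ?J" for c a
    proof -
      obtain a' where a': "a' \<in> I (Suc j) \<inter> perp K S {e}" "a = proj a'"
        using ca by blast
      then have "c \<odot>\<^bsub>S\<^esub> a' \<in> I (Suc j) \<inter> perp K S {e}" "proj (c \<odot>\<^bsub>S\<^esub> a') = c \<odot>\<^bsub>S\<^esub> a"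
        using sub(4)[OF \<open>j \<le> n\<close>] ca by (simp_all add: mem_perp form_smult_left)
      then show ?thesis by (metis image_eqI reduct_simps(4))
    qed
    show "bracket reduct x a \<in> ?J" if xa: "x \<in> carrier reduct" "a \<in> ?J" for x a
    proof -
      obtain a' where a': "a' \<in> I (Suc j) \<inter> perp K S {e}" "a = proj a'"
        using xa by blast
      then have "bracket S x a' \<in> I (Suc j) \<inter> perp K S {e}" "proj (bracket S x a') = bracket reduct x a"
        using sub(5)[OF \<open>j \<le> n\<close>] xa by (simp_all add: mem_perp form_bracket_e)
      then show ?thesis by (metis image_eqI)
    qed
  qed
  show "\<exists>c\<in>carrier K. b \<ominus>\<^bsub>reduct\<^esub> c \<odot>\<^bsub>reduct\<^esub> x \<in> proj ` (I (Suc j) \<inter> perp K S {e})"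
    if j: "j < n" and x: "x \<in> proj ` (I (Suc (Suc j)) \<inter> perp K S {e}) - proj ` (I (Suc j) \<inter> perp K S {e})"
    and b: "b \<in> proj ` (I (Suc (Suc j)) \<inter> perp K S {e})" for j x b
  proof -
    interpret red: vectorspace K reduct by (rule vectorspace_reduct)
    obtain x' b' where x': "x' \<in> I (Suc (Suc j))" "x' \<in> perp K S {e}" "x = proj x'"
      and b': "b' \<in> I (Suc (Suc j))" "b' \<in> perp K S {e}" "b = proj b'"
      using x b by blast
    \<comment> \<open>Otherwise \<open>x\<close> would lie in the smaller image. So the codimension
      property of the old chain applies to \<open>x'\<close> and \<open>b'\<close>, and the same
      \<open>c\<close> serves for their projections.\<close>
    have "x' \<notin> I (Suc j)" using x x' by blast
    then obtain c where c: "c \<in> carrier K" "b' \<ominus>\<^bsub>S\<^esub> c \<odot>\<^bsub>S\<^esub> x' \<in> I (Suc j)"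
      using chain j x' b' unfolding codim_1_chain_def by (metis DiffI Suc_less_eq)
    have m: "b' \<ominus>\<^bsub>S\<^esub> c \<odot>\<^bsub>S\<^esub> x' \<in> I (Suc j) \<inter> perp K S {e}"
      using c x' b' by (simp add: mem_perp form_minus_left form_smult_left)
    have "x \<in> carrier reduct" "b \<in> carrier reduct" using proj_perp_eq x' b' by auto
    \<comment> \<open>Additive inverses depend on the carrier, so subtraction in
      \<open>reduct\<close> is not literally that of \<open>S\<close>. Scaling by the negative of
      \<open>c\<close> uses only operations which the two structures share.\<close>
    then have "b \<ominus>\<^bsub>reduct\<^esub> c \<odot>\<^bsub>reduct\<^esub> x = b \<oplus>\<^bsub>reduct\<^esub> (\<ominus>\<^bsub>K\<^esub> c) \<odot>\<^bsub>reduct\<^esub> x"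
      using c red.smult_l_minus[of c x] by (simp add: a_minus_def)
    also have "\<dots> = proj (b' \<ominus>\<^bsub>S\<^esub> c \<odot>\<^bsub>S\<^esub> x')"
      using c x' b' by (simp add: mem_perp a_minus_def smult_l_minus)
    finally show ?thesis using m c by blast
  qed
qed

end

section \<open>Induction on the length of the chain\<close>

lemma completely_reducible_step:
  fixes S T :: "('k, 'v) symplectic_lie"
  assumes S: "symplectic_lie_algebra K S" and T: "is_symplectic_reduction_of K T S"
    and "completely_reducible K T"
  shows "completely_reducible K S"
proof -
  obtain n X where X: "X 0 = T" "\<forall>i\<le>n. symplectic_lie_algebra K (X i)"
    "\<forall>i<n. is_symplectic_reduction_of K (X (Suc i)) (X i)" "carrier (X n) = {\<zero>\<^bsub>X n\<^esub>}"
    using assms(3) unfolding completely_reducible_def by blast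
  define Y where "Y = case_nat S X"
  have "Y 0 = S" "carrier (Y (Suc n)) = {\<zero>\<^bsub>Y (Suc n)\<^esub>}" using X by (simp_all add: Y_def)
  moreover have "\<forall>i\<le>Suc n. symplectic_lie_algebra K (Y i)"
    using X S by (auto simp: Y_def split: nat.split)
  moreover have "\<forall>i<Suc n. is_symplectic_reduction_of K (Y (Suc i)) (Y i)"
    using X T by (auto simp: Y_def split: nat.split)
  ultimately show ?thesis unfolding completely_reducible_def by blast
qed

text \<open>This handles a collapsed first step: the chain gets shorter while the algebra stays the
  same.\<close>

lemma codim_1_chain_shift:
  assumes "codim_1_chain K L (Suc n) I" "I 1 = {\<zero>\<^bsub>L\<^esub>}"
  shows "codim_1_chain K L n (\<lambda>j. I (Suc j))"
  using assms by (simp add: codim_1_chain_def)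

text \<open>Any nonzero \<open>e\<close> in \<open>I 1\<close> spans it, since \<open>I 0\<close> is
  zero and the step has codimension at most one; that \<open>I 1\<close> is an ideal then gives
  \<open>bracket_e\<close>.\<close>

lemma (in symplectic_lie_algebra) exists_symplectic_lie_line:
  assumes chain: "codim_1_chain K S (Suc n) I" and "I 1 \<noteq> {\<zero>\<^bsub>S\<^esub>}"
  obtains e y where "symplectic_lie_line K S e y" "I 1 = {c \<odot>\<^bsub>S\<^esub> e | c. c \<in> carrier K}"
proof -
  have I: "lie_ideal K (I 1) S"
    and codim: "\<And>x b. x \<in> I 1 - {\<zero>\<^bsub>S\<^esub>} \<Longrightarrow> b \<in> I 1 \<Longrightarrow> \<exists>c\<in>carrier K. b \<ominus>\<^bsub>S\<^esub> c \<odot>\<^bsub>S\<^esub> x = \<zero>\<^bsub>S\<^esub>"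
    using chain by (auto simp: codim_1_chain_def)
  then have sub: "I 1 \<subseteq> carrier S" "\<zero>\<^bsub>S\<^esub> \<in> I 1"
    "\<And>c a. c \<in> carrier K \<Longrightarrow> a \<in> I 1 \<Longrightarrow> c \<odot>\<^bsub>S\<^esub> a \<in> I 1"
    "\<And>x a. x \<in> carrier S \<Longrightarrow> a \<in> I 1 \<Longrightarrow> bracket S x a \<in> I 1"
    unfolding lie_ideal_def subspace_def submodule_def by blast+
  obtain e where e: "e \<in> I 1" "e \<noteq> \<zero>\<^bsub>S\<^esub>" using assms(2) sub(2) by blast
  then have eS: "e \<in> carrier S" using sub by blast
  have I1: "\<exists>c\<in>carrier K. b = c \<odot>\<^bsub>S\<^esub> e" if b: "b \<in> I 1" for b
  proof -
    obtain c where "c \<in> carrier K" "b \<ominus>\<^bsub>S\<^esub> c \<odot>\<^bsub>S\<^esub> e = \<zero>\<^bsub>S\<^esub>" using codim e b by blast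
    moreover have "b \<in> carrier S" using b sub by blast
    ultimately show ?thesis using eS by (metis M.diff_add_cancel M.r_zero smult_closed)
  qed
  obtain z where z: "z \<in> carrier S" "form S e z \<noteq> \<zero>\<^bsub>K\<^esub>"
    using form_nondegenerate[OF eS] e by blast
  \<comment> \<open>Nondegeneracy only gives a nonzero pairing with \<open>z\<close>; scaling
    \<open>z\<close> by \<open>u\<close> makes it one.\<close>
  define u where "u = inv\<^bsub>K\<^esub> form S e z"
  have "form S e z \<in> Units K" using z eS by (simp add: field_Units form_closed)
  then have u: "u \<in> carrier K" "u \<otimes>\<^bsub>K\<^esub> form S e z = \<one>\<^bsub>K\<^esub>" by (simp_all add: u_def)
  show ?thesis
  proof (rule that)
    show "I 1 = {c \<odot>\<^bsub>S\<^esub> e | c. c \<in> carrier K}" using I1 sub(3) e by blast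
    show "symplectic_lie_line K S e (u \<odot>\<^bsub>S\<^esub> z)"
    proof
      show "\<exists>c\<in>carrier K. bracket S x e = c \<odot>\<^bsub>S\<^esub> e" if "x \<in> carrier S" for x
        using that I1 sub(4) e by blast
    qed (use z u eS in \<open>simp_all add: form_smult_right\<close>)
  qed
qed

lemma codim_1_chain_imp_completely_reducible:
  fixes S :: "('k, 'v) symplectic_lie"
  assumes "symplectic_lie_algebra K S" "codim_1_chain K S n I"
  shows "completely_reducible K S"
  using assms
proof (induction n arbitrary: S I)
  case 0
  \<comment> \<open>For length zero, \<open>I 0\<close> is both the bottom and the top of the
    chain.\<close>
  then have "carrier S = {\<zero>\<^bsub>S\<^esub>}" by (auto simp: codim_1_chain_def)
  then show ?case
    unfolding completely_reducible_def
    using "0.prems"(1) by (intro exI[of _ 0] exI[of _ "\<lambda>_. S"]) simp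
next
  case (Suc n)
  interpret symplectic_lie_algebra K S by (rule Suc.prems)
  show ?case
  proof (cases "I 1 = {\<zero>\<^bsub>S\<^esub>}")
    case True
    then show ?thesis using Suc.IH Suc.prems codim_1_chain_shift by blast
  next
    case False
    from exists_symplectic_lie_line[OF Suc.prems(2) this] obtain e y where
      line: "symplectic_lie_line K S e y" and I1: "I 1 = {c \<odot>\<^bsub>S\<^esub> e | c. c \<in> carrier K}" .
    interpret line: symplectic_lie_line K S e y by (rule line)
    have "completely_reducible K line.reduct"
      by (rule Suc.IH[OF line.symplectic_lie_algebra_reduct line.reduct_chain[OF Suc.prems(2)]])
        (simp add: line.line_def I1[simplified])
    with line.reduct_is_reduction show ?thesis
      by (rule completely_reducible_step[OF Suc.prems(1)])
  qed
qed

theorem theorem3p6: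
  fixes K :: "('k, 'r) ring_scheme" and S :: "('k, 'v) symplectic_lie"
  assumes "symplectic_lie_algebra K S"
    and "completely_solvable K S"
  shows "completely_reducible K S"
  using lie_algebra.completely_solvable_imp_codim_1_chain[OF _ assms(2)]
    codim_1_chain_imp_completely_reducible[OF assms(1)] assms(1)
  by (auto simp: symplectic_lie_algebra_def)

end
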